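(* For every integer $m\ge 3$, $\mathrm{forb}(m,F(0,3,1,0))=\lfloor \tfrac{7}{3}m\rfloor+1$.
   Context: A matrix is simple if it is a $(0,1)$-matrix with no repeated columns. For $(0,1)$-matrices $F,A$, $F$ is a configuration in $A$ (written $F\prec A$) if some submatrix of $A$ is a row and column permutation of $F$. $\mathrm{Avoid}(m,F)$ is the set of all simple $m$-rowed matrices $A$ with $F\not\prec A$, and $\mathrm{forb}(m,F)$ is the maximum number of columns of a matrix in $\mathrm{Avoid}(m,F)$. $F(0,3,1,0)$ is the $2\times 4$ matrix whose first $3$ columns are $\binom{1}{0}$ and whose last column is $\binom{0}{1}$. *)

theory Defs
  imports "HOL-Combinatorics.Permutations" "Jordan_Normal_Form.DL_Submatrix" Complex_Main
begin

definition zero_one_mat :: "int mat \<Rightarrow> bool" where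
  "zero_one_mat A \<longleftrightarrow> elements_mat A \<subseteq> {0, 1}"

definition simple_mat :: "int mat \<Rightarrow> bool" where
  "simple_mat A \<longleftrightarrow> zero_one_mat A \<and> distinct (cols A)"

definition row_col_permutation :: "int mat \<Rightarrow> int mat \<Rightarrow> bool" where
  "row_col_permutation F B \<longleftrightarrow>
    (\<exists>p q. p permutes {..<dim_row F} \<and> q permutes {..<dim_col F} \<and>
      B = mat (dim_row F) (dim_col F) (\<lambda>(i, j). F $$ (p i, q j)))"

definition configuration :: "int mat \<Rightarrow> int mat \<Rightarrow> bool"  (infix "\<prec>" 50) where
  "F \<prec> A \<longleftrightarrow>
    (\<exists>I J. I \<subseteq> {..<dim_row A} \<and> J \<subseteq> {..<dim_col A} \<and>
      row_col_permutation F (submatrix A I J))"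

definition Avoid :: "nat \<Rightarrow> int mat \<Rightarrow> int mat set" where
  "Avoid m F = {A. dim_row A = m \<and> simple_mat A \<and> \<not> F \<prec> A}"

definition forb :: "nat \<Rightarrow> int mat \<Rightarrow> nat" where
  "forb m F = Max (dim_col ` Avoid m F)"

definition F_0_3_1_0 :: "int mat" where
  "F_0_3_1_0 = mat_of_rows_list 4
    [[1, 1, 1, 0],
     [0, 0, 0, 1]]"

(* The two lemmas below show that the maximum defining forb is a genuine one:
   the set of column counts is finite, and nonempty as soon as F has a column. *)

lemma finite_dim_col_Avoid: "finite (dim_col ` Avoid m F)"
proof -
  let ?V = "{v :: int vec. dim_vec v = m \<and> set\<^sub>v v \<subseteq> {0, 1}}"
  have "?V \<subseteq> vec_of_list ` {xs. set xs \<subseteq> {0, 1} \<and> length xs = m}"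
  proof
    fix v :: "int vec" assume "v \<in> ?V"
    then have "list_of_vec v \<in> {xs. set xs \<subseteq> {0, 1} \<and> length xs = m}"
      by (simp add: set_list_of_vec)
    then show "v \<in> vec_of_list ` {xs. set xs \<subseteq> {0, 1} \<and> length xs = m}"
      by (metis image_eqI vec_list)
  qed
  then have fin: "finite ?V"
    by (rule finite_subset) (intro finite_imageI finite_lists_length_eq, simp)
  have "dim_col A \<le> card ?V" if "A \<in> Avoid m F" for A
  proof -
    have A: "dim_row A = m" "elements_mat A \<subseteq> {0, 1}" "distinct (cols A)"
      using that by (auto simp: Avoid_def simple_mat_def zero_one_mat_def)
    have "set (cols A) \<subseteq> ?V"
    proof
      fix v assume "v \<in> set (cols A)"
      then obtain j where j: "j < dim_col A" "v = col A j"
        by (auto simp: cols_def)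
      have "v $ i \<in> {0, 1}" if "i < m" for i
      proof -
        have "A $$ (i, j) \<in> elements_mat A"
          using that j A(1) by (intro elements_matI[of A m "dim_col A"]) auto
        then show ?thesis using that j A by auto
      qed
      then show "v \<in> ?V"
        using j A(1) by (auto simp: vec_set_def)
    qed
    then have "card (set (cols A)) \<le> card ?V"
      by (rule card_mono[OF fin])
    then show ?thesis
      using A(3) by (simp add: distinct_card)
  qed
  then have "dim_col ` Avoid m F \<subseteq> {..card ?V}" by auto
  then show ?thesis by (rule finite_subset) simp
qed

lemma Avoid_nonempty:
  assumes "dim_col F > 0"
  shows "Avoid m F \<noteq> {}"
proof -
  have "\<not> F \<prec> 0\<^sub>m m 0"
  proof
    assume "F \<prec> 0\<^sub>m m 0"
    then obtain I J where "row_col_permutation F (submatrix (0\<^sub>m m 0) I J)"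
      by (auto simp: configuration_def)
    then have "dim_col (submatrix (0\<^sub>m m 0 :: int mat) I J) = dim_col F"
      by (auto simp: row_col_permutation_def)
    then show False
      using assms by (simp add: dim_submatrix)
  qed
  then have "0\<^sub>m m 0 \<in> Avoid m F"
    by (auto simp: Avoid_def simple_mat_def zero_one_mat_def cols_def elements_mat_def)
  then show ?thesis by blast
qed

end

theory Submission
  imports Defs
begin

text \<open>
  Read a column as the set of rows in which it has a 1. A matrix avoids \<open>F(0,3,1,0)\<close> iff for all
  rows \<open>i, j\<close>, three columns containing \<open>i\<close> but not \<open>j\<close> exclude a column containing \<open>j\<close> but not \<open>i\<close>.

  Upper bound, by induction on the number of rows. Call \<open>X\<close> doubled at \<open>i\<close> if \<open>i \<notin> X\<close> and both \<open>X\<close>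
  and \<open>X \<union> {i}\<close> are columns. If at most two sets are doubled at \<open>i\<close>, deleting row \<open>i\<close> loses at most
  two columns. Otherwise pick three doubled sets, let \<open>P\<close> be the rows distinguishing them, and
  delete \<open>T = P \<union> {i}\<close>. The six columns coming from the triple already nearly saturate the
  condition for each pair \<open>i, j\<close> with \<open>j \<in> P\<close>, so for each such \<open>j\<close> at most one further column
  differs in rows \<open>i\<close> and \<open>j\<close>; the six columns agree outside \<open>T\<close>, and every column with another
  trace outside \<open>T\<close> has its entry in row \<open>i\<close> forced by that trace. Hence at most \<open>7 |T| / 3\<close> columns
  are lost.

  Lower bound: for \<open>m = 3, 4, 5\<close> take all sets of size at most 1 or at least \<open>m - 1\<close>; three new
  rows allow seven new columns, namely the old full set joined with any nonempty set of new rows.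
\<close>

section \<open>Set families and the deletion of rows\<close>

definition avoids :: "'a set \<Rightarrow> 'a set set \<Rightarrow> bool" where
  "avoids R A \<longleftrightarrow> (\<forall>i\<in>R. \<forall>j\<in>R. 3 \<le> card {X \<in> A. i \<in> X \<and> j \<notin> X} \<longrightarrow>
     {X \<in> A. j \<in> X \<and> i \<notin> X} = {})"

text \<open>Distinct traces lift to distinct members of \<open>A\<close> with the same entries in
  the surviving rows \<open>i\<close> and \<open>j\<close>, so three traces on one side come from
  three columns on that side.\<close>

lemma avoids_image_Diff:
  assumes "avoids R A" "finite A"
  shows "avoids (R - T) ((\<lambda>X. X - T) ` A)"
  unfolding avoids_def
proof (intro ballI impI)
  fix i j assume ij: "i \<in> R - T" "j \<in> R - T"
    and 3: "3 \<le> card {X \<in> (\<lambda>X. X - T) ` A. i \<in> X \<and> j \<notin> X}"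
  have "{X \<in> (\<lambda>X. X - T) ` A. i \<in> X \<and> j \<notin> X} \<subseteq> (\<lambda>X. X - T) ` {X \<in> A. i \<in> X \<and> j \<notin> X}"
    using ij by auto
  then have "card {X \<in> (\<lambda>X. X - T) ` A. i \<in> X \<and> j \<notin> X} \<le> card {X \<in> A. i \<in> X \<and> j \<notin> X}"
    using assms(2) by (intro surj_card_le) simp_all
  then have "3 \<le> card {X \<in> A. i \<in> X \<and> j \<notin> X}" using 3 by linarith
  then have "{X \<in> A. j \<in> X \<and> i \<notin> X} = {}"
    using assms(1) ij unfolding avoids_def by blast
  then show "{X \<in> (\<lambda>X. X - T) ` A. j \<in> X \<and> i \<notin> X} = {}"
    using ij by blast
qed

subsection \<open>Deleting the rows that separate a doubled triple\<close>

locale doubled_triple =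
  fixes R :: "'a set" and A :: "'a set set" and i :: 'a and C :: "'a set set"
  assumes finite_R: "finite R" and A_sub: "A \<subseteq> Pow R" and avoids_RA: "avoids R A"
    and i_in: "i \<in> R" and C_sub: "C \<subseteq> {X \<in> A. i \<notin> X \<and> insert i X \<in> A}" and card_C: "card C = 3"
begin

definition S where "S = C \<union> insert i ` C"

definition P where "P = {j \<in> R - {i}. (\<exists>X\<in>C. j \<in> X) \<and> (\<exists>X\<in>C. j \<notin> X)}"

definition T where "T = insert i P"

definition E where "E j = {Y \<in> A - S. (j \<in> Y) \<noteq> (i \<in> Y)}"

text \<open>The common trace of \<open>C\<close> outside \<open>T\<close>. The intersection yields
  it because the members agree there, while \<open>i\<close> lies in no member and each row of
  \<open>P\<close> is missed by some member.\<close>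

definition W where "W = \<Inter>C"

text \<open>The columns outside \<open>S\<close> that have the same trace outside \<open>T\<close> as \<open>S\<close> and are constant on \<open>T\<close>.\<close>

definition K where "K = {W, W \<union> T} \<inter> A - S"

lemma finite_A: "finite A" using finite_R A_sub by (meson finite_Pow_iff finite_subset)

lemma finite_C: "finite C" using card_C by (intro card_ge_0_finite) simp

lemma C_ne: "C \<noteq> {}" using card_C by auto

lemma finite_P: "finite P" using finite_R by (simp add: P_def)

lemma S_sub: "S \<subseteq> A" using C_sub by (auto simp: S_def)

lemma card_S: "card S = 6"
proof -
  have "inj_on (insert i) C" using C_sub by (auto simp: inj_on_def)
  moreover have "C \<inter> insert i ` C = {}" using C_sub by auto
  ultimately show ?thesis
    by (simp add: S_def card_Un_disjoint finite_C card_image card_C)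
qed

text \<open>Any three columns exhibited as \<open>B\<close> suffice, so later arguments need not
  compute the full set of columns on that side.\<close>

lemma avoidsD:
  assumes "j \<in> R" "k \<in> R" "B \<subseteq> {X \<in> A. j \<in> X \<and> k \<notin> X}" "3 \<le> card B" "Y \<in> A" "k \<in> Y" "j \<notin> Y"
  shows False
proof -
  have "card B \<le> card {X \<in> A. j \<in> X \<and> k \<notin> X}"
    using finite_A by (intro card_mono assms) auto
  then have "{X \<in> A. k \<in> X \<and> j \<notin> X} = {}"
    using avoids_RA assms(1,2,4) unfolding avoids_def by (meson order_trans)
  then show False using assms(5-7) by blast
qed

lemma C_memD:
  assumes "X \<in> C"
  shows "X - T = W" "X \<in> A" "insert i X \<in> A" "i \<notin> X" "X \<subseteq> R"
proof -
  show "X \<in> A" "insert i X \<in> A" "i \<notin> X" "X \<subseteq> R" using assms C_sub A_sub by auto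
  show "X - T = W"
  proof
    show "X - T \<subseteq> W" using assms C_sub A_sub by (auto simp: T_def P_def W_def)
    show "W \<subseteq> X - T" using assms C_sub by (auto simp: T_def P_def W_def)
  qed
qed

lemma C_eqI: "X = Y" if "X \<in> C" "Y \<in> C" "X \<inter> P = Y \<inter> P"
proof -
  have "X = (X - T) \<union> (X \<inter> P)" "Y = (Y - T) \<union> (Y \<inter> P)"
    using C_memD(4)[OF that(1)] C_memD(4)[OF that(2)] by (auto simp: T_def)
  then show ?thesis using C_memD(1)[OF that(1)] C_memD(1)[OF that(2)] that(3) by metis
qed

text \<open>Members \<open>a\<close> containing \<open>j\<close> and \<open>b\<close> missing
  \<open>j\<close> give \<open>a\<close> on one side of the pair \<open>i, j\<close> and
  \<open>insert i b\<close> on the other. Both sides are thus inhabited, so each has at most two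
  columns. Of these at most four, \<open>S\<close> supplies three: from each \<open>X\<close> in
  \<open>C\<close>, either \<open>X\<close> or \<open>insert i X\<close>.\<close>

lemma card_E_le:
  assumes "j \<in> P"
  shows "card (E j) \<le> 1"
proof -
  let ?U1 = "{Y \<in> A. i \<in> Y \<and> j \<notin> Y}" and ?U2 = "{Y \<in> A. j \<in> Y \<and> i \<notin> Y}"
  from assms obtain a b where ab: "a \<in> C" "j \<in> a" "b \<in> C" "j \<notin> b" and j: "j \<in> R" "j \<noteq> i"
    by (auto simp: P_def)
  have "card ?U1 < 3"
    using avoidsD[OF i_in j(1) order_refl _ C_memD(2)[OF ab(1)] ab(2)] C_memD(4)[OF ab(1)] by force
  moreover have "card ?U2 < 3"
    using avoidsD[OF j(1) i_in order_refl _ C_memD(3)[OF ab(3)]] ab j by force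
  moreover have "card (?U1 \<union> ?U2) \<le> card ?U1 + card ?U2" by (rule card_Un_le)
  ultimately have 4: "card (?U1 \<union> ?U2) \<le> 4" by linarith
  let ?V1 = "{X \<in> C. j \<in> X}" and ?V2 = "{X \<in> C. j \<notin> X}"
  have "card (?V1 \<union> insert i ` ?V2) = card ?V1 + card (insert i ` ?V2)"
    using finite_C C_sub by (intro card_Un_disjoint) auto
  also have "card (insert i ` ?V2) = card ?V2"
    using C_sub by (intro card_image) (auto simp: inj_on_def)
  also have "card ?V1 + card ?V2 = card (?V1 \<union> ?V2)"
    using finite_C by (intro card_Un_disjoint[symmetric]) auto
  also have "?V1 \<union> ?V2 = C" by auto
  finally have V: "card (?V1 \<union> insert i ` ?V2) = 3" by (simp add: card_C)
  have "card (E j) + card (?V1 \<union> insert i ` ?V2) = card (E j \<union> (?V1 \<union> insert i ` ?V2))"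
    using finite_A finite_C by (intro card_Un_disjoint[symmetric]) (auto simp: E_def S_def)
  also have "\<dots> \<le> card (?U1 \<union> ?U2)"
    using finite_A C_sub j by (intro card_mono) (auto simp: E_def)
  finally show ?thesis using V 4 by simp
qed

lemma card_UN_E_le:
  assumes "Q \<subseteq> P" shows "card (\<Union>j\<in>Q. E j) \<le> card Q"
proof -
  have "finite Q" using assms finite_P by (rule finite_subset)
  then have "card (\<Union>j\<in>Q. E j) \<le> (\<Sum>j\<in>Q. card (E j))" by (rule card_UN_le)
  also have "\<dots> \<le> (\<Sum>j\<in>Q. 1)" using assms by (intro sum_mono card_E_le) auto
  finally show ?thesis by simp
qed

text \<open>All of \<open>C\<close> agrees in row \<open>r\<close>. If \<open>r\<close> is in
  \<open>W\<close>, the three members contain \<open>r\<close> and miss \<open>i\<close>; otherwise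
  their three doubles contain \<open>i\<close> and miss \<open>r\<close>. Either way the opposite
  side is empty.\<close>

lemma mem_outside:
  assumes "Y \<in> A" "r \<in> R - T"
  shows "r \<in> W \<Longrightarrow> r \<notin> Y \<Longrightarrow> i \<notin> Y" "r \<notin> W \<Longrightarrow> r \<in> Y \<Longrightarrow> i \<in> Y"
proof -
  have r: "r \<in> R" "r \<noteq> i" using assms by (auto simp: T_def)
  have const: "r \<in> X \<longleftrightarrow> r \<in> W" if "X \<in> C" for X
    using C_memD(1)[OF that] assms(2) by auto
  have c: "card (insert i ` C) = 3"
    using C_sub by (subst card_image) (auto simp: inj_on_def card_C)
  show "i \<notin> Y" if "r \<in> W" "r \<notin> Y"
    using avoidsD[OF r(1) i_in, of C Y] that const C_sub assms card_C by auto
  show "i \<in> Y" if "r \<notin> W" "r \<in> Y"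
    using avoidsD[OF i_in r(1), of "insert i ` C" Y] that const C_sub assms c r by auto
qed

text \<open>Outside \<open>S\<close> and the sets in some \<open>E j\<close>, every member is constant on \<open>T\<close>, and
  its value there is forced by its trace outside \<open>T\<close> unless that trace is \<open>W\<close>.\<close>

lemma inj_on_trace:
  assumes "p \<in> C"
  shows "inj_on (\<lambda>X. X - T) (A - (S - {p} \<union> (\<Union>j\<in>P. E j) \<union> K))" (is "inj_on _ ?B")
proof (rule inj_onI)
  have const: "Y \<inter> T = (if i \<in> Y then T else {})" if "Y \<in> ?B" "Y \<noteq> p" for Y
    using that by (auto simp: T_def E_def)
  \<comment> \<open>With \<open>K\<close> removed, \<open>p\<close> is the only remaining set with
    trace \<open>W\<close>, so it collides with nothing.\<close>
  have notW: "Y - T \<noteq> W" if "Y \<in> ?B" "Y \<noteq> p" for Y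
  proof
    assume W: "Y - T = W"
    have "Y = Y - T \<union> Y \<inter> T" by auto
    then have "Y = W \<or> Y = W \<union> T" using W const[OF that] by (cases "i \<in> Y") simp_all
    then show False using that by (auto simp: K_def)
  qed
  fix Y Z assume Y: "Y \<in> ?B" and Z: "Z \<in> ?B" and eq: "Y - T = Z - T"
  show "Y = Z"
  proof (cases "Y = p \<or> Z = p")
    case True
    then show ?thesis using notW[OF Y] notW[OF Z] eq C_memD(1)[OF assms] by metis
  next
    case False
    have "Y - T \<noteq> W" using notW Y False by auto
    \<comment> \<open>At a row where the shared trace differs from \<open>W\<close>,
      \<open>mem_outside\<close> fixes the entry in row \<open>i\<close> for both sets.\<close>
    then obtain r where r: "r \<in> Y - T \<longleftrightarrow> r \<notin> W" by auto
    have W: "W \<subseteq> R - T" using C_memD[OF assms] by auto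
    have rR: "r \<in> R - T" using r W Y A_sub by (cases "r \<in> W") auto
    have "i \<in> Y \<longleftrightarrow> i \<in> Z"
      using mem_outside[of Y r] mem_outside[of Z r] rR Y Z r eq by blast
    moreover have "Y = Y - T \<union> Y \<inter> T" "Z = Z - T \<union> Z \<inter> T" by auto
    ultimately show ?thesis using const[OF Y] const[OF Z] False eq by metis
  qed
qed

text \<open>Such a member equals \<open>W\<close>, which therefore already belongs to
  \<open>S\<close>.\<close>

lemma W_notin_K: "W \<notin> K" if "X \<in> C" "X \<inter> P = {}"
proof -
  have "X = W" using C_memD[OF that(1)] that(2) by (auto simp: T_def)
  then show ?thesis using that by (auto simp: K_def S_def)
qed

text \<open>The double of such a member is \<open>W \<union> T\<close>, which therefore already
  belongs to \<open>S\<close>.\<close>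

lemma WT_notin_K: "W \<union> T \<notin> K" if "X \<in> C" "P \<subseteq> X"
proof -
  have "insert i X = W \<union> T" using C_memD[OF that(1)] that(2) by (auto simp: T_def)
  then show ?thesis using that by (auto simp: K_def S_def)
qed

section \<open>How the rows of \<open>P\<close> split the triple\<close>

definition pos where "pos j a \<longleftrightarrow> a \<in> C \<and> j \<in> a \<and> (\<forall>X\<in>C - {a}. j \<notin> X)"

definition neg where "neg j a \<longleftrightarrow> a \<in> C \<and> j \<notin> a \<and> (\<forall>X\<in>C - {a}. j \<in> X)"

text \<open>A row that is not constant on three members splits them one against two.\<close>

lemma pos_or_neg:
  assumes "j \<in> P" obtains a where "pos j a" | a where "neg j a"
proof -
  from card_C obtain x y z where C: "C = {x, y, z}" "x \<noteq> y" "y \<noteq> z" "x \<noteq> z"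
    by (auto simp: card_3_iff)
  have "j \<in> x \<or> j \<in> y \<or> j \<in> z" "j \<notin> x \<or> j \<notin> y \<or> j \<notin> z"
    using assms unfolding P_def unfolding C(1) by auto
  then have "pos j x \<or> pos j y \<or> pos j z \<or> neg j x \<or> neg j y \<or> neg j z"
    using C(2-) unfolding pos_def neg_def unfolding C(1) by auto
  then show ?thesis using that by blast
qed

lemma card_doubled_pair:
  assumes "D \<subseteq> C" "2 \<le> card D"
  shows "3 \<le> card (D \<union> insert i ` D)"
proof -
  have f: "finite D" using assms finite_C finite_subset by blast
  have "card (insert i ` D) = card D"
    using C_sub assms by (intro card_image) (auto simp: inj_on_def)
  moreover have "D \<inter> insert i ` D = {}" using C_sub assms by auto
  ultimately show ?thesis using assms f by (simp add: card_Un_disjoint)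
qed

text \<open>The other two members and their doubles are four columns containing \<open>k\<close> but
  not \<open>j\<close>, while \<open>a\<close> contains \<open>j\<close> but not
  \<open>k\<close>.\<close>

lemma not_pos_neg:
  assumes "j \<in> P" "k \<in> P" "pos j a" "neg k a"
  shows False
proof (rule avoidsD)
  let ?D = "C - {a}"
  have a: "a \<in> C" using assms by (simp add: pos_def)
  show "3 \<le> card (?D \<union> insert i ` ?D)"
    using a finite_C card_C by (intro card_doubled_pair) auto
  show "?D \<union> insert i ` ?D \<subseteq> {X \<in> A. k \<in> X \<and> j \<notin> X}"
    using assms C_sub by (auto simp: pos_def neg_def P_def)
  show "a \<in> A" "j \<in> a" "k \<notin> a" using assms C_sub by (auto simp: pos_def neg_def)
  show "k \<in> R" "j \<in> R" using assms by (auto simp: P_def)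
qed

lemma card_insert_pair:
  assumes "a \<in> C" "e \<notin> S"
  shows "3 \<le> card {a, insert i a, e}"
proof -
  have "a \<noteq> insert i a" "e \<noteq> a" "e \<noteq> insert i a"
    using assms C_sub by (auto simp: S_def)
  then show ?thesis by simp
qed

text \<open>If \<open>e \<in> E j\<close> missed \<open>k\<close>, then \<open>e\<close>, \<open>a\<close> and \<open>insert i a\<close> would contain \<open>j\<close> but not \<open>k\<close>,
  while \<open>b\<close> contains \<open>k\<close> but not \<open>j\<close>.\<close>

lemma pos_E_subset:
  assumes "j \<in> P" "k \<in> P" "pos j a" "pos k b" "a \<noteq> b"
  shows "E j \<subseteq> E k"
proof
  fix e assume e: "e \<in> E j"
  have jk: "j \<in> R" "k \<in> R" "j \<noteq> i" "k \<noteq> i" using assms by (auto simp: P_def)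
  have ab: "a \<in> C" "b \<in> C" "j \<in> a" "k \<notin> a" "k \<in> b" "j \<notin> b"
    using assms by (auto simp: pos_def)
  let ?D = "C - {a}"
  \<comment> \<open>Otherwise \<open>e\<close> misses \<open>j\<close>, so \<open>e\<close> and the
    doubles of the two members other than \<open>a\<close> contain \<open>i\<close> but not
    \<open>j\<close>, against \<open>a\<close>.\<close>
  have "i \<notin> e"
  proof
    assume ie: "i \<in> e"
    have "card (insert i ` ?D) = card ?D"
      using C_sub by (intro card_image) (auto simp: inj_on_def)
    also have "\<dots> = 2" using ab card_C finite_C by simp
    finally have "card (insert e (insert i ` ?D)) = 3"
      using e finite_C by (subst card_insert_disjoint) (auto simp: E_def S_def)
    then show False
      using avoidsD[of i j "insert e (insert i ` ?D)" a] ie e jk i_in ab assms C_sub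
      by (auto simp: E_def pos_def)
  qed
  then have "j \<in> e" using e by (auto simp: E_def)
  have "k \<in> e"
  proof (rule ccontr)
    assume "k \<notin> e"
    then show False
      using avoidsD[of j k "{a, insert i a, e}" b] card_insert_pair[of a e] \<open>j \<in> e\<close> ab e jk C_sub
      by (auto simp: E_def)
  qed
  then show "e \<in> E k" using e \<open>i \<notin> e\<close> by (auto simp: E_def)
qed

text \<open>The mirror image of \<open>pos_E_subset\<close>, with containing and missing exchanged:
  \<open>e\<close> must contain \<open>i\<close> and miss both \<open>j\<close> and
  \<open>k\<close>.\<close>

lemma neg_E_subset:
  assumes "j \<in> P" "k \<in> P" "neg j a" "neg k b" "a \<noteq> b"
  shows "E j \<subseteq> E k"
proof
  fix e assume e: "e \<in> E j"
  have jk: "j \<in> R" "k \<in> R" "j \<noteq> i" "k \<noteq> i" using assms by (auto simp: P_def)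
  have ab: "a \<in> C" "b \<in> C" "j \<notin> a" "k \<in> a" "k \<notin> b" "j \<in> b"
    using assms by (auto simp: neg_def)
  let ?D = "C - {a}"
  have "i \<in> e"
  proof (rule ccontr)
    assume ie: "i \<notin> e"
    have "card ?D = 2" using ab card_C finite_C by simp
    then have "card (insert e ?D) = 3"
      using e finite_C by (subst card_insert_disjoint) (auto simp: E_def S_def)
    then show False
      using avoidsD[of j i "insert e ?D" "insert i a"] ie e jk i_in ab assms C_sub
      by (auto simp: E_def neg_def)
  qed
  then have "j \<notin> e" using e by (auto simp: E_def)
  have "k \<notin> e"
  proof
    assume "k \<in> e"
    then show False
      using avoidsD[of k j "{a, insert i a, e}" b] card_insert_pair[of a e] \<open>j \<notin> e\<close> ab e jk C_sub
      by (auto simp: E_def)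
  qed
  then show "e \<in> E k" using e \<open>i \<in> e\<close> by (auto simp: E_def)
qed

text \<open>\<open>E j\<close> is absorbed by \<open>E k\<close>, so the union can be taken over one
  row fewer.\<close>

lemma card_UN_E_less:
  assumes "j \<in> P" "k \<in> P" "E j \<subseteq> E k" "j \<noteq> k"
  shows "card (\<Union>l\<in>P. E l) + 1 \<le> card P"
proof -
  have "(\<Union>l\<in>P. E l) = (\<Union>l\<in>P - {j}. E l)" using assms by auto
  moreover have "card (P - {j}) + 1 = card P"
    using assms finite_P by (metis Suc_eq_plus1 card_Suc_Diff1)
  ultimately show ?thesis using card_UN_E_le[of "P - {j}"] by auto
qed

section \<open>Counting the discarded columns\<close>

text \<open>The three members have distinct traces on \<open>P\<close>, and one row allows only two
  traces.\<close>

lemma two_le_card_P: "2 \<le> card P"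
proof -
  have "3 = card ((\<lambda>X. X \<inter> P) ` C)"
    using C_eqI card_C by (subst card_image) (auto simp: inj_on_def)
  also have "\<dots> \<le> card (Pow P)" using finite_P by (intro card_mono) auto
  finally have *: "3 \<le> (2::nat) ^ card P" using finite_P by (simp add: card_Pow)
  show ?thesis
  proof (rule ccontr)
    assume "\<not> 2 \<le> card P"
    then have "card P = 0 \<or> card P = 1" by auto
    then show False using * by auto
  qed
qed

lemma card_K_cases:
  shows "card K \<le> 2" "W \<notin> K \<Longrightarrow> card K \<le> 1" "W \<union> T \<notin> K \<Longrightarrow> card K \<le> 1"
    "W \<notin> K \<Longrightarrow> W \<union> T \<notin> K \<Longrightarrow> card K = 0"
proof -
  have "K \<subseteq> {W, W \<union> T}" by (auto simp: K_def)
  then have "card K \<le> card {W, W \<union> T}" by (intro card_mono) auto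
  also have "\<dots> \<le> 2" by (simp add: card_insert_if)
  finally show "card K \<le> 2" .
  show "card K \<le> 1" if "W \<notin> K"
    using that card_mono[of "{W \<union> T}" K] by (auto simp: K_def)
  show "card K \<le> 1" if "W \<union> T \<notin> K"
    using that card_mono[of "{W}" K] by (auto simp: K_def)
  show "card K = 0" if "W \<notin> K" "W \<union> T \<notin> K"
    using that by (auto simp: K_def)
qed

text \<open>The two members other than \<open>a\<close> must be told apart by some row of \<open>P\<close>.\<close>

lemma obtain_splitter:
  assumes "a \<in> C"
  obtains k where "k \<in> P" "\<not> pos k a" "\<not> neg k a"
proof -
  have "card (C - {a}) = 2" using assms finite_C card_C by simp
  then obtain b c where "C - {a} = {b, c}" "b \<noteq> c" by (auto simp: card_2_iff)
  then have bc: "b \<in> C" "c \<in> C" "b \<noteq> c" "b \<noteq> a" "c \<noteq> a" by blast+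
  then obtain k where "k \<in> P" "k \<in> b \<longleftrightarrow> k \<notin> c" using C_eqI[OF bc(1,2)] by blast
  then show ?thesis using that bc by (auto simp: pos_def neg_def)
qed

lemma obtain_third:
  obtains c where "c \<in> C" "c \<noteq> a" "c \<noteq> b"
proof -
  from card_C obtain x y z where "C = {x, y, z}" "x \<noteq> y" "y \<noteq> z" "x \<noteq> z"
    by (auto simp: card_3_iff)
  then show ?thesis using that by (cases "x = a \<or> x = b"; cases "y = a \<or> y = b") auto
qed

text \<open>This is \<open>3 * (5 + card (\<Union>j\<in>P. E j) + card K) \<le> 7 * (card P +
  1)\<close> rearranged, with 5 for \<open>S\<close> without one member. The trivial bounds
  \<open>card P\<close> and 2 suffice when \<open>card P\<close> is at least 4. For three rows a
  saving of one is needed, for two rows a saving of two; the savings depend on which kinds of split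
  occur.\<close>

lemma discard_bound: "8 + 3 * card (\<Union>j\<in>P. E j) + 3 * card K \<le> 7 * card P"
proof -
  have E: "card (\<Union>j\<in>P. E j) \<le> card P" by (rule card_UN_E_le) simp
  note K = card_K_cases
  obtain j0 where j0: "j0 \<in> P" using two_le_card_P by force
  consider (pos) "\<And>j a. j \<in> P \<Longrightarrow> \<not> neg j a" | (neg) "\<And>j a. j \<in> P \<Longrightarrow> \<not> pos j a"
    | (mixed) j a k b where "j \<in> P" "k \<in> P" "pos j a" "neg k b" by blast
  then show ?thesis
  proof cases
    case pos
    obtain a where a: "pos j0 a" using pos_or_neg[OF j0] pos[OF j0] by metis
    then have "a \<in> C" by (simp add: pos_def)
    then obtain k where k: "k \<in> P" "\<not> pos k a" by (rule obtain_splitter)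
    obtain b where b: "pos k b" using pos_or_neg[OF k(1)] pos[OF k(1)] by metis
    \<comment> \<open>Two rows singling out different members make one \<open>E\<close> contain the
      other, which saves one.\<close>
    have "a \<noteq> b" "j0 \<noteq> k" using a b k by auto
    then have E1: "card (\<Union>j\<in>P. E j) + 1 \<le> card P"
      using card_UN_E_less pos_E_subset j0 k(1) a b by metis
    show ?thesis
    proof (cases "card P = 2")
      case True
      then have P: "P = {j0, k}" using j0 k(1) \<open>j0 \<noteq> k\<close> by (auto simp: card_2_iff)
      \<comment> \<open>The third member is singled out by neither row, so it misses all of
        \<open>P\<close> and \<open>W\<close> drops out of \<open>K\<close>: the second
        saving.\<close>
      obtain c where c: "c \<in> C" "c \<noteq> a" "c \<noteq> b" by (rule obtain_third)
      then have "c \<inter> P = {}" using a b P by (auto simp: pos_def)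
      then show ?thesis using W_notin_K[OF c(1)] K(2) E1 True by auto
    next
      case False
      then show ?thesis using E1 E K(1) two_le_card_P by linarith
    qed
  next
    case neg
    obtain a where a: "neg j0 a" using pos_or_neg[OF j0] neg[OF j0] by metis
    then have "a \<in> C" by (simp add: neg_def)
    then obtain k where k: "k \<in> P" "\<not> neg k a" by (rule obtain_splitter)
    obtain b where b: "neg k b" using pos_or_neg[OF k(1)] neg[OF k(1)] by metis
    have "a \<noteq> b" "j0 \<noteq> k" using a b k by auto
    then have E1: "card (\<Union>j\<in>P. E j) + 1 \<le> card P"
      using card_UN_E_less neg_E_subset j0 k(1) a b by metis
    show ?thesis
    proof (cases "card P = 2")
      case True
      then have P: "P = {j0, k}" using j0 k(1) \<open>j0 \<noteq> k\<close> by (auto simp: card_2_iff)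
      obtain c where c: "c \<in> C" "c \<noteq> a" "c \<noteq> b" by (rule obtain_third)
      then have "P \<subseteq> c" using a b P by (auto simp: neg_def)
      then show ?thesis using WT_notin_K[OF c(1)] K(3) E1 True by auto
    next
      case False
      then show ?thesis using E1 E K(1) two_le_card_P by linarith
    qed
  next
    case mixed
    obtain c where c: "c \<in> C" "c \<noteq> a" "c \<noteq> b" by (rule obtain_third)
    have "j \<notin> c" "k \<in> c" using mixed(3,4) c by (auto simp: pos_def neg_def)
    moreover have "a \<noteq> b" using not_pos_neg[OF mixed(1-3)] mixed(4) by blast
    ultimately have ab: "a \<in> C" "b \<in> C" "a \<noteq> b" "j \<noteq> k"
      using mixed(3,4) by (auto simp: pos_def neg_def)
    \<comment> \<open>If both were in \<open>K\<close>, some row \<open>l\<close> would lie in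
      \<open>b\<close> and some row \<open>l'\<close> outside \<open>a\<close>. As \<open>a\<close>
      is already singled out positively and \<open>b\<close> negatively, \<open>not_pos_neg\<close>
      leaves only \<open>c\<close> for \<open>l\<close> and \<open>l'\<close>, with opposite signs,
      and so excludes this too.\<close>
    have "W \<notin> K \<or> W \<union> T \<notin> K"
    proof (rule ccontr)
      assume "\<not> ?thesis"
      then have "\<not> b \<inter> P = {}" "\<not> P \<subseteq> a" using W_notin_K WT_notin_K ab by blast+
      then obtain l l' where l: "l \<in> P" "l \<in> b" "l' \<in> P" "l' \<notin> a" by auto
      have "\<not> pos l b" using not_pos_neg[OF l(1) mixed(2) _ mixed(4)] by blast
      have "\<not> neg l' a" using not_pos_neg[OF mixed(1) l(3) mixed(3)] by blast
      have C: "C = {a, b, c}"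
        using card_subset_eq[of C "{a, b, c}"] ab c finite_C card_C by auto
      have "neg l c"
      proof (rule pos_or_neg[OF l(1)])
        fix x assume "pos l x"
        then show ?thesis using \<open>\<not> pos l b\<close> l(2) ab(2) by (cases "x = b") (simp_all add: pos_def)
      next
        fix x assume x: "neg l x"
        then have "x \<noteq> a" using not_pos_neg[OF mixed(1) l(1) mixed(3)] by auto
        moreover have "x \<in> C" "l \<notin> x" using x by (simp_all add: neg_def)
        ultimately have "x = c" using l(2) C by blast
        then show ?thesis using x by simp
      qed
      moreover have "pos l' c"
      proof (rule pos_or_neg[OF l(3)])
        fix x assume "neg l' x"
        then show ?thesis using \<open>\<not> neg l' a\<close> l(4) ab(1) by (cases "x = a") (simp_all add: neg_def)
      next
        fix x assume x: "pos l' x"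
        then have "x \<noteq> b" using not_pos_neg[OF l(3) mixed(2) _ mixed(4)] by auto
        moreover have "x \<in> C" "l' \<in> x" using x by (simp_all add: pos_def)
        ultimately have "x = c" using l(4) C by blast
        then show ?thesis using x by simp
      qed
      ultimately show False using not_pos_neg[OF l(3,1)] by blast
    qed
    then have K1: "card K \<le> 1" using K by blast
    show ?thesis
    proof (cases "card P = 2")
      case True
      then have P: "P = {j, k}" using mixed ab by (auto simp: card_2_iff)
      have "P \<subseteq> a" "b \<inter> P = {}" using mixed P ab by (auto simp: pos_def neg_def)
      then have "card K = 0" using W_notin_K WT_notin_K ab K(4) by blast
      then show ?thesis using E True by auto
    next
      case False
      then show ?thesis using E K1 two_le_card_P by linarith
    qed
  qed
qed

lemma card_A_le: "3 * card A \<le> 3 * card ((\<lambda>X. X - T) ` A) + 7 * card T"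
proof -
  obtain p where p: "p \<in> C" using C_ne by auto
  \<comment> \<open>One member \<open>p\<close> stays behind to represent the trace
    \<open>W\<close>, so \<open>S\<close> costs five columns rather than six.\<close>
  let ?D = "S - {p} \<union> (\<Union>j\<in>P. E j) \<union> K"
  have "card (S - {p}) = 5" using card_S p by (simp add: S_def)
  then have "card ?D \<le> 5 + card (\<Union>j\<in>P. E j) + card K"
    using card_Un_le[of "S - {p} \<union> (\<Union>j\<in>P. E j)" K] card_Un_le[of "S - {p}" "\<Union>j\<in>P. E j"]
    by linarith
  moreover have "card T = card P + 1" using finite_P by (simp add: T_def P_def)
  ultimately have D: "3 * card ?D \<le> 7 * card T" using discard_bound by linarith
  have "?D \<subseteq> A" using S_sub by (auto simp: E_def K_def)
  then have "card A = card (A - ?D) + card ?D"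
    using finite_A by (metis card_Diff_subset card_mono finite_subset le_add_diff_inverse2)
  also have "card (A - ?D) = card ((\<lambda>X. X - T) ` (A - ?D))"
    by (rule card_image[symmetric, OF inj_on_trace[OF p]])
  also have "\<dots> \<le> card ((\<lambda>X. X - T) ` A)" using finite_A by (intro card_mono) auto
  finally show ?thesis using D by linarith
qed

end

section \<open>The upper bound by induction on the number of rows\<close>

text \<open>Deleting row \<open>i\<close> only merges \<open>X\<close> with
  \<open>insert i X\<close>; dropping the lower set of each such pair leaves an injective
  map.\<close>

lemma card_le_card_image_Diff:
  assumes "finite A"
  shows "card A \<le> card ((\<lambda>X. X - {i}) ` A) + card {X \<in> A. i \<notin> X \<and> insert i X \<in> A}"
proof -
  let ?C = "{X \<in> A. i \<notin> X \<and> insert i X \<in> A}"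
  have "inj_on (\<lambda>X. X - {i}) (A - ?C)"
  proof (rule inj_onI)
    fix Y Z assume h: "Y \<in> A - ?C" "Z \<in> A - ?C" "Y - {i} = Z - {i}"
    show "Y = Z"
    proof (cases "i \<in> Y"; cases "i \<in> Z")
      assume "i \<in> Y" "i \<notin> Z"
      then have "Y = insert i Z" using h by auto
      then show ?thesis using h \<open>i \<notin> Z\<close> by auto
    next
      assume "i \<notin> Y" "i \<in> Z"
      then have "Z = insert i Y" using h by auto
      then show ?thesis using h \<open>i \<notin> Y\<close> by auto
    qed (use h in auto)
  qed
  then have "card (A - ?C) = card ((\<lambda>X. X - {i}) ` (A - ?C))" by (simp add: card_image)
  also have "\<dots> \<le> card ((\<lambda>X. X - {i}) ` A)" using assms by (intro card_mono) auto
  finally have "card (A - ?C) \<le> card ((\<lambda>X. X - {i}) ` A)" .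
  moreover have "card A = card (A - ?C) + card ?C"
    using assms by (metis (no_types, lifting) card_Diff_subset card_mono finite_subset
        le_add_diff_inverse2 mem_Collect_eq subsetI)
  ultimately show ?thesis by linarith
qed

text \<open>Multiplying by 3 avoids the floor. Strong induction is needed because the number of
  deleted rows varies.\<close>

lemma avoids_card_le:
  assumes "finite R" "A \<subseteq> Pow R" "avoids R A"
  shows "3 * card A \<le> 7 * card R + 3"
  using assms
proof (induction "card R" arbitrary: R A rule: less_induct)
  case less
  have fA: "finite A" using less.prems by (meson finite_Pow_iff finite_subset)
  have step: "3 * card ((\<lambda>X. X - T) ` A) + 7 * card T \<le> 7 * card R + 3"
    if "T \<subseteq> R" "T \<noteq> {}" for T
  proof -
    have fT: "finite T" using that less.prems finite_subset by blast
    then have c: "card R = card (R - T) + card T" "0 < card T"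
      using that less.prems by (auto simp: card_Diff_subset card_mono card_gt_0_iff)
    have "3 * card ((\<lambda>X. X - T) ` A) \<le> 7 * card (R - T) + 3"
      using c less.prems avoids_image_Diff[OF less.prems(3) fA]
      by (intro less.hyps) auto
    then show ?thesis using c by simp
  qed
  show ?case
  proof (cases "R = {}")
    case True
    then have "A \<subseteq> {{}}" using less.prems by auto
    then have "card A \<le> card {{} :: 'a set}" by (intro card_mono) auto
    then show ?thesis by simp
  next
    case False
    then obtain i where i: "i \<in> R" by auto
    let ?C = "{X \<in> A. i \<notin> X \<and> insert i X \<in> A}"
    show ?thesis
    \<comment> \<open>One row may cost \<open>7 / 3\<close> columns, so losing two is affordable;
      three doubled sets call for the larger deletion.\<close>
    proof (cases "card ?C \<le> 2")
      case True
      then show ?thesis using step[of "{i}"] card_le_card_image_Diff[OF fA, of i] i by auto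
    next
      case False
      then obtain C where C: "C \<subseteq> ?C" "card C = 3"
        using obtain_subset_with_card_n[of 3 ?C] by auto
      interpret doubled_triple R A i C
        by (rule doubled_triple.intro) (fact less.prems i C)+
      have "T \<subseteq> R" "T \<noteq> {}" using i by (auto simp: T_def P_def)
      then show ?thesis using step[of T] card_A_le by linarith
    qed
  qed
qed

subsection \<open>Extremal families\<close>

text \<open>New columns contain every old row, so they do not separate two old rows. A column
  containing a new row contains all old ones, so pairs of an old and a new row are separated in one
  direction only.\<close>

lemma avoids_extend:
  fixes m :: nat
  assumes "A \<subseteq> Pow {..<m}" "{..<m} \<in> A" "avoids {..<m} A"
  obtains B where "B \<subseteq> Pow {..<m + 3}" "{..<m + 3} \<in> B" "avoids {..<m + 3} B" "card B = card A + 7"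
proof -
  let ?U = "{m, m + 1, m + 2}"
  define N where "N = (\<lambda>X. {..<m} \<union> X) ` (Pow ?U - {{}})"
  have fA: "finite A" using assms(1) by (meson finite_Pow_iff finite_lessThan finite_subset)
  have U: "{..<m + 3} = {..<m} \<union> ?U" by auto
  have inj: "inj_on (\<lambda>X. {..<m} \<union> X) (Pow ?U - {{}})"
    by (rule inj_on_inverseI[where g = "\<lambda>X. X - {..<m}"]) auto
  have "card (Pow ?U - {{}}) = 7" by (simp add: card_Diff_subset card_Pow)
  then have "card N = 7" unfolding N_def using inj by (simp add: card_image)
  moreover have "A \<inter> N = {}"
  proof -
    have "X \<notin> A" if "X \<in> N" for X
    proof -
      from that obtain x where "x \<in> X" "x \<in> ?U" by (auto simp: N_def)
      then have "\<not> X \<subseteq> {..<m}" by auto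
      then show ?thesis using assms(1) by blast
    qed
    then show ?thesis by blast
  qed
  moreover have "finite N" by (simp add: N_def)
  ultimately have card: "card (A \<union> N) = card A + 7" using fA by (simp add: card_Un_disjoint)
  have sub: "A \<union> N \<subseteq> Pow {..<m + 3}" unfolding U using assms(1) by (auto simp: N_def)
  have top: "{..<m + 3} \<in> A \<union> N" unfolding U N_def by blast
  have "avoids {..<m + 3} (A \<union> N)"
    unfolding avoids_def
  proof (intro ballI impI)
    fix i j assume ij: "i \<in> {..<m + 3}" "j \<in> {..<m + 3}"
      and 3: "3 \<le> card {X \<in> A \<union> N. i \<in> X \<and> j \<notin> X}"
    show "{X \<in> A \<union> N. j \<in> X \<and> i \<notin> X} = {}"
    proof (cases "i < m")
      case i: True
      show ?thesis
      proof (cases "j < m")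
        case True
        then have eq: "{X \<in> A \<union> N. i \<in> X \<and> j \<notin> X} = {X \<in> A. i \<in> X \<and> j \<notin> X}"
          "{X \<in> A \<union> N. j \<in> X \<and> i \<notin> X} = {X \<in> A. j \<in> X \<and> i \<notin> X}"
          using i by (auto simp: N_def)
        have "{X \<in> A. j \<in> X \<and> i \<notin> X} = {}"
          using assms(3) 3[unfolded eq(1)] i True unfolding avoids_def by blast
        then show ?thesis by (simp only: eq(2))
      next
        case False
        then show ?thesis using i assms(1) by (auto simp: N_def)
      qed
    next
      case i: False
      show ?thesis
      proof (cases "j < m")
        case True
        then have "{X \<in> A \<union> N. i \<in> X \<and> j \<notin> X} = {}"
          using i assms(1) by (auto simp: N_def)
        then show ?thesis using 3 by (metis card.empty not_numeral_le_zero)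
      next
        case False
        show ?thesis
        proof (cases "i = j")
          case False
          \<comment> \<open>For two new rows only the third new row is free, which leaves at most
            two columns on each side.\<close>
          have "{i, j} \<subseteq> ?U" using ij i \<open>\<not> j < m\<close> by auto
          then have "card (?U - {i, j}) = card ?U - card {i, j}" by (intro card_Diff_subset) simp
          then have "card (?U - {i, j}) = 1" using False by simp
          then have "card (Pow (?U - {i, j})) = 2" by (simp add: card_Pow)
          moreover have "{X \<in> A \<union> N. i \<in> X \<and> j \<notin> X} \<subseteq>
            (\<lambda>X. {..<m} \<union> insert i X) ` Pow (?U - {i, j})"
          proof
            fix X assume X: "X \<in> {X \<in> A \<union> N. i \<in> X \<and> j \<notin> X}"
            then have "X \<in> N" using i assms(1) by auto
            then obtain Z where Z: "Z \<subseteq> ?U" "X = {..<m} \<union> Z" by (auto simp: N_def)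
            then have "X = {..<m} \<union> insert i (Z - {i})" "Z - {i} \<in> Pow (?U - {i, j})"
              using X i by auto
            then show "X \<in> (\<lambda>X. {..<m} \<union> insert i X) ` Pow (?U - {i, j})" by blast
          qed
          ultimately have "card {X \<in> A \<union> N. i \<in> X \<and> j \<notin> X} \<le> 2"
            using surj_card_le[of "Pow (?U - {i, j})" "{X \<in> A \<union> N. i \<in> X \<and> j \<notin> X}"] by simp
          then show ?thesis using 3 by linarith
        qed auto
      qed
    qed
  qed
  then show ?thesis using that sub top card by blast
qed

lemma obtain_avoids_card_linear:
  fixes m :: nat
  assumes "3 \<le> m"
  obtains A where "A \<subseteq> Pow {..<m}" "{..<m} \<in> A" "avoids {..<m} A" "card A = 2 * m + 2"
proof -
  let ?U = "{..<m}"
  let ?S = "(\<lambda>i. {i}) ` ?U" and ?C = "(\<lambda>i. ?U - {i}) ` ?U"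
  define A where "A = {{}, ?U} \<union> ?S \<union> ?C"
  have cS: "card ?S = m" by (subst card_image) (auto simp: inj_on_def)
  have cC: "card ?C = m" by (subst card_image) (auto simp: inj_on_def)
  have c: "card X = m - 1" if "X \<in> ?C" for X using that by auto
  have s: "card X = 1" if "X \<in> ?S" for X using that by auto
  have k: "card X = 0 \<or> card X = m" if "X \<in> {{}, ?U}" for X using that by auto
  \<comment> \<open>The parts are told apart by the sizes of their members: 0, 1,
    \<open>m - 1\<close> and \<open>m\<close> are pairwise distinct once \<open>m\<close> is at
    least 3.\<close>
  have disj: "X \<inter> Y = {}" if "\<And>x y. x \<in> X \<Longrightarrow> y \<in> Y \<Longrightarrow> card x \<noteq> card y"
    for X Y :: "nat set set"
    using that by blast
  have "{{}, ?U} \<inter> ?S = {}"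
  proof (rule disj)
    fix x y assume "x \<in> {{}, ?U}" "y \<in> ?S"
    then show "card x \<noteq> card y" using k[of x] s[of y] assms by arith
  qed
  moreover have "({{}, ?U} \<union> ?S) \<inter> ?C = {}"
  proof (rule disj)
    fix x y assume "x \<in> {{}, ?U} \<union> ?S" "y \<in> ?C"
    then show "card x \<noteq> card y" using k[of x] s[of x] c[of y] assms by (elim UnE) arith+
  qed
  moreover have "card {{}, ?U} = 2"
  proof -
    have "0 \<in> ?U" using assms by simp
    then have "{} \<noteq> ?U" by blast
    then show ?thesis by (simp only: card_2_iff) blast
  qed
  ultimately have "card A = 2 * m + 2" unfolding A_def using cS cC
    by (subst card_Un_disjoint, simp, simp, blast, subst card_Un_disjoint) (simp_all del: Un_insert_left)
  moreover have "avoids ?U A"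
    unfolding avoids_def
  proof (intro ballI impI)
    fix i j assume ij: "i \<in> ?U" "j \<in> ?U" and 3: "3 \<le> card {X \<in> A. i \<in> X \<and> j \<notin> X}"
    \<comment> \<open>Only one singleton and one co-singleton can separate the rows in this
      direction, so three columns never occur.\<close>
    have "{X \<in> A. i \<in> X \<and> j \<notin> X} \<subseteq> {{i}, ?U - {j}}" using ij by (auto simp: A_def)
    then have "card {X \<in> A. i \<in> X \<and> j \<notin> X} \<le> card {{i}, ?U - {j}}" by (intro card_mono) auto
    also have "\<dots> \<le> 2" by (simp add: card_insert_if)
    finally show "{X \<in> A. j \<in> X \<and> i \<notin> X} = {}" using 3 by simp
  qed
  moreover have "A \<subseteq> Pow ?U" "?U \<in> A" by (auto simp: A_def)
  ultimately show ?thesis using that by blast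
qed

text \<open>The values 8, 10, 12 of \<open>2 * m + 2\<close> at 3, 4, 5 match the formula, and both
  the construction and the formula grow by 7 per three rows.\<close>

lemma exists_avoids_card:
  assumes "3 \<le> m"
  shows "\<exists>A \<subseteq> Pow {..<m}. {..<m} \<in> A \<and> avoids {..<m} A \<and> card A = 7 * m div 3 + 1"
  using assms
proof (induction m rule: less_induct)
  case (less m)
  show ?case
  proof (cases "m < 6")
    case True
    then have "m = 3 \<or> m = 4 \<or> m = 5" using less.prems by linarith
    then have "7 * m div 3 + 1 = 2 * m + 2" by auto
    then show ?thesis using obtain_avoids_card_linear[OF less.prems] by metis
  next
    case False
    then have "\<exists>k\<ge>3. m = k + 3" by presburger
    then obtain k where k: "3 \<le> k" "m = k + 3" by blast
    then obtain A where "A \<subseteq> Pow {..<k}" "{..<k} \<in> A" "avoids {..<k} A" "card A = 7 * k div 3 + 1"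
      using less.IH[of k] by auto
    then obtain B where "B \<subseteq> Pow {..<m}" "{..<m} \<in> B" "avoids {..<m} B"
      "card B = 7 * k div 3 + 1 + 7"
      unfolding k(2) using avoids_extend by metis
    moreover have "7 * m div 3 = 7 * k div 3 + 7" unfolding k(2) by simp
    ultimately show ?thesis by auto
  qed
qed

subsection \<open>Matrices and set families\<close>

lemma F_0_3_1_0_index:
  "dim_row F_0_3_1_0 = 2" "dim_col F_0_3_1_0 = 4"
  "r < 2 \<Longrightarrow> c < 4 \<Longrightarrow> F_0_3_1_0 $$ (r, c) = of_bool ((r = 0) = (c < 3))"
proof -
  show "dim_row F_0_3_1_0 = 2" "dim_col F_0_3_1_0 = 4"
    by (simp_all add: F_0_3_1_0_def mat_of_rows_list_def)
  assume "r < 2" "c < 4"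
  then have "r = 0 \<or> r = 1" "c = 0 \<or> c = 1 \<or> c = 2 \<or> c = 3" by linarith+
  then show "F_0_3_1_0 $$ (r, c) = of_bool ((r = 0) = (c < 3))"
    by (auto simp: F_0_3_1_0_def mat_of_rows_list_def)
qed

text \<open>\<open>pick I\<close> is strictly increasing on these indices, hence injective, and a
  count gives surjectivity.\<close>

lemma bij_betw_pick:
  assumes "finite I"
  shows "bij_betw (pick I) {..<card I} I"
proof -
  have inj: "inj_on (pick I) {..<card I}"
    by (metis (no_types, lifting) inj_onI lessThan_iff linorder_neqE_nat nat_less_le pick_mono_le)
  moreover have "pick I ` {..<card I} \<subseteq> I" by (auto intro: pick_in_set_le)
  ultimately have "pick I ` {..<card I} = I"
    using assms by (intro card_subset_eq) (simp_all add: card_image)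
  then show ?thesis using inj by (simp add: bij_betw_def)
qed

lemma configuration_F_0_3_1_0_iff:
  assumes "zero_one_mat A"
  shows "F_0_3_1_0 \<prec> A \<longleftrightarrow>
    (\<exists>i<dim_row A. \<exists>j<dim_row A. \<exists>C \<subseteq> {c. c < dim_col A \<and> A $$ (i, c) = 1 \<and> A $$ (j, c) \<noteq> 1}.
      card C = 3 \<and> (\<exists>d<dim_col A. A $$ (j, d) = 1 \<and> A $$ (i, d) \<noteq> 1))"
    (is "_ \<longleftrightarrow> ?R")
proof
  assume "F_0_3_1_0 \<prec> A"
  then obtain I J p q where IJ: "I \<subseteq> {..<dim_row A}" "J \<subseteq> {..<dim_col A}"
    and p: "p permutes {..<2}" and q: "q permutes {..<4}"
    and eq: "submatrix A I J = mat 2 4 (\<lambda>(r, c). F_0_3_1_0 $$ (p r, q c))"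
    by (auto simp: configuration_def row_col_permutation_def F_0_3_1_0_index)
  have sets: "{i. i < dim_row A \<and> i \<in> I} = I" "{j. j < dim_col A \<and> j \<in> J} = J"
    using IJ by auto
  have cIJ: "card I = 2" "card J = 4"
    using arg_cong[OF eq, of dim_row] arg_cong[OF eq, of dim_col]
    by (simp_all add: dim_submatrix sets)
  have fin: "finite J" using IJ finite_subset by blast
  \<comment> \<open>The entry of \<open>F_0_3_1_0\<close> at \<open>(r, c)\<close> sits in the
    submatrix at \<open>(p' r, q' c)\<close>, hence the inverses.\<close>
  define p' q' where "p' = inv_into UNIV p" and "q' = inv_into UNIV q"
  have p': "p' permutes {..<2}" and q': "q' permutes {..<4}"
    using permutes_inv[OF p] permutes_inv[OF q] by (simp_all add: p'_def q'_def)
  have entry: "A $$ (pick I (p' r), pick J (q' c)) = of_bool ((r = 0) = (c < 3))"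
    if "r < 2" "c < 4" for r c
  proof -
    have r: "p' r < 2" and c: "q' c < 4"
      using permutes_in_image[OF p'] permutes_in_image[OF q'] that
      by auto
    have "A $$ (pick I (p' r), pick J (q' c)) = submatrix A I J $$ (p' r, q' c)"
      using r c by (simp add: submatrix_index sets cIJ)
    also have "\<dots> = F_0_3_1_0 $$ (r, c)"
      using r c by (simp add: eq permutes_inverses(1)[OF p, folded p'_def] permutes_inverses(1)[OF q, folded q'_def])
    finally show ?thesis using that by (simp add: F_0_3_1_0_index)
  qed
  have row: "pick I (p' r) < dim_row A" if "r < 2" for r
    using pick_in_set_le[of "p' r" I] permutes_in_image[OF p', of r] that IJ cIJ
    by auto
  have bij: "bij_betw (\<lambda>c. pick J (q' c)) {..<4} J"
    using bij_betw_trans[OF permutes_imp_bij[OF q'] bij_betw_pick[OF fin, unfolded cIJ]]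
    by (simp add: comp_def)
  have col: "pick J (q' c) < dim_col A" if "c < 4" for c
    using bij_betwE[OF bij] that IJ by auto
  show ?R
  proof (intro exI conjI)
    show "pick I (p' 0) < dim_row A" "pick I (p' 1) < dim_row A" using row by auto
    let ?C = "(\<lambda>c. pick J (q' c)) ` {..<3}"
    have "inj_on (\<lambda>c. pick J (q' c)) {..<3}"
      by (rule inj_on_subset[OF bij_betw_imp_inj_on[OF bij]]) auto
    then show "card ?C = 3" by (simp add: card_image)
    show "?C \<subseteq> {c. c < dim_col A \<and> A $$ (pick I (p' 0), c) = 1 \<and> A $$ (pick I (p' 1), c) \<noteq> 1}"
      using col entry by auto
    show "pick J (q' 3) < dim_col A" "A $$ (pick I (p' 1), pick J (q' 3)) = 1"
      "A $$ (pick I (p' 0), pick J (q' 3)) \<noteq> 1"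
      using col entry by auto
  qed
next
  assume ?R
  then obtain i j C d where ij: "i < dim_row A" "j < dim_row A"
    and C: "C \<subseteq> {c. c < dim_col A \<and> A $$ (i, c) = 1 \<and> A $$ (j, c) \<noteq> 1}" "card C = 3"
    and d: "d < dim_col A" "A $$ (j, d) = 1" "A $$ (i, d) \<noteq> 1"
    by blast
  define I J where "I = {i, j}" and "J = insert d C"
  have "i \<noteq> j" using d by auto
  then have cI: "card I = 2" and finI: "finite I" by (simp_all add: I_def)
  have "finite C" "d \<notin> C" using C d by (auto intro: card_ge_0_finite)
  then have cJ: "card J = 4" and fin: "finite J" using C(2) by (simp_all add: J_def)
  have sub: "I \<subseteq> {..<dim_row A}" "J \<subseteq> {..<dim_col A}" using ij C(1) d by (auto simp: I_def J_def)
  then have sets: "{r. r < dim_row A \<and> r \<in> I} = I" "{c. c < dim_col A \<and> c \<in> J} = J" by auto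
  note bI = bij_betw_pick[OF finI, unfolded cI] and bJ = bij_betw_pick[OF fin, unfolded cJ]
  note eI = bij_betwE[OF bI, rule_format] and eJ = bij_betwE[OF bJ, rule_format]
  have memI: "x = i \<or> x = j" if "x \<in> I" for x using that by (simp add: I_def)
  have memJ: "x = d \<or> x \<in> C" if "x \<in> J" for x using that by (simp add: J_def)
  have "i \<in> I" "d \<in> J" by (simp_all add: I_def J_def)
  then obtain r0 c0 where r0: "r0 < 2" "pick I r0 = i" and c0: "c0 < 4" "pick J c0 = d"
    using bij_betw_imp_surj_on[OF bI] bij_betw_imp_surj_on[OF bJ] by (metis imageE lessThan_iff)
  \<comment> \<open>The first three columns of \<open>F_0_3_1_0\<close> are equal, so only the
    positions of row \<open>i\<close> and column \<open>d\<close> matter and one transposition on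
    each side suffices.\<close>
  let ?p = "Transposition.transpose 0 r0" and ?q = "Transposition.transpose 3 c0"
  have "submatrix A I J = mat 2 4 (\<lambda>(r, c). F_0_3_1_0 $$ (?p r, ?q c))"
  proof (rule eq_matI)
    fix r c assume "r < dim_row (mat 2 4 (\<lambda>(r, c). F_0_3_1_0 $$ (?p r, ?q c)))"
      "c < dim_col (mat 2 4 (\<lambda>(r, c). F_0_3_1_0 $$ (?p r, ?q c)))"
    then have rc: "r < 2" "c < 4" by auto
    have r: "pick I r = (if r = r0 then i else j)"
      using eI[of r] inj_onD[OF bij_betw_imp_inj_on[OF bI], of r r0] r0 rc(1) memI by fastforce
    have c: "if c = c0 then pick J c = d else pick J c \<in> C"
      using eJ[of c] inj_onD[OF bij_betw_imp_inj_on[OF bJ], of c c0] c0 rc(2) memJ by fastforce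
    have "A $$ (x, y) \<in> {0, 1}" if "x \<in> I" "y \<in> J" for x y
      using assms sub that unfolding zero_one_mat_def
      by (meson carrier_matI elements_matI lessThan_iff subsetD)
    then have A0: "A $$ (i, d) = 0" "y \<in> C \<Longrightarrow> A $$ (j, y) = 0" for y
      using d C(1) ij by (auto simp: I_def J_def)
    have "submatrix A I J $$ (r, c) = A $$ (pick I r, pick J c)"
      using rc by (simp add: submatrix_index sets cI cJ)
    also have "\<dots> = of_bool ((r = r0) = (c \<noteq> c0))"
      using r c A0 C(1) d by (auto split: if_splits)
    also have "\<dots> = of_bool ((?p r = 0) = (?q c < 3))"
    proof -
      have "?p r = 0 \<longleftrightarrow> r = r0" by (auto simp: transpose_def)
      moreover have "?q c < 3 \<longleftrightarrow> c \<noteq> c0" using c0 rc by (auto simp: transpose_def)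
      ultimately show ?thesis by simp
    qed
    also have "\<dots> = F_0_3_1_0 $$ (?p r, ?q c)"
      using rc r0 c0 by (subst F_0_3_1_0_index) (auto simp: transpose_def)
    finally show "submatrix A I J $$ (r, c) = mat 2 4 (\<lambda>(r, c). F_0_3_1_0 $$ (?p r, ?q c)) $$ (r, c)"
      using rc by simp
  qed (simp_all add: dim_submatrix sets cI cJ)
  moreover have "?p permutes {..<2}" "?q permutes {..<4}"
    using r0 c0 by (auto intro!: permutes_swap_id)
  ultimately show "F_0_3_1_0 \<prec> A"
    unfolding configuration_def row_col_permutation_def F_0_3_1_0_index using sub by blast
qed

text \<open>Each column becomes the set of rows where it has a 1; since entries are 0 or 1, distinct
  columns give distinct sets.\<close>

lemma Avoid_imp_avoids:
  assumes "A \<in> Avoid m F_0_3_1_0"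
  obtains B where "B \<subseteq> Pow {..<m}" "avoids {..<m} B" "card B = dim_col A"
proof -
  have A: "dim_row A = m" "zero_one_mat A" "distinct (cols A)" "\<not> F_0_3_1_0 \<prec> A"
    using assms by (auto simp: Avoid_def simple_mat_def)
  define s where "s c = {r. r < m \<and> A $$ (r, c) = 1}" for c
  have zo: "A $$ (r, c) = 0 \<or> A $$ (r, c) = 1" if "r < m" "c < dim_col A" for r c
  proof -
    have "A $$ (r, c) \<in> elements_mat A"
      using that A(1) by (intro elements_matI[OF carrier_matI]) auto
    then show ?thesis using A(2) unfolding zero_one_mat_def by blast
  qed
  have "inj_on s {..<dim_col A}"
  proof (rule inj_onI)
    fix c d assume cd: "c \<in> {..<dim_col A}" "d \<in> {..<dim_col A}" "s c = s d"
    have "A $$ (r, c) = A $$ (r, d)" if "r < m" for r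
    proof -
      have "r \<in> s c \<longleftrightarrow> r \<in> s d" using cd(3) by simp
      then have "A $$ (r, c) = 1 \<longleftrightarrow> A $$ (r, d) = 1" using that by (simp add: s_def)
      moreover have "A $$ (r, c) = 0 \<or> A $$ (r, c) = 1" "A $$ (r, d) = 0 \<or> A $$ (r, d) = 1"
        using zo[OF that] cd(1,2) by auto
      ultimately show ?thesis by auto
    qed
    then have "col A c = col A d" using A(1) cd(1,2) by (intro eq_vecI) auto
    then show "c = d" using nth_eq_iff_index_eq[OF A(3), of c d] cd(1,2) by simp
  qed
  then have card: "card (s ` {..<dim_col A}) = dim_col A" by (simp add: card_image)
  have "avoids {..<m} (s ` {..<dim_col A})"
    unfolding avoids_def
  proof (intro ballI impI, rule ccontr)
    fix i j assume ij: "i \<in> {..<m}" "j \<in> {..<m}"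
      and 3: "3 \<le> card {X \<in> s ` {..<dim_col A}. i \<in> X \<and> j \<notin> X}"
      and ne: "{X \<in> s ` {..<dim_col A}. j \<in> X \<and> i \<notin> X} \<noteq> {}"
    let ?D = "{c. c < dim_col A \<and> A $$ (i, c) = 1 \<and> A $$ (j, c) \<noteq> 1}"
    have "{X \<in> s ` {..<dim_col A}. i \<in> X \<and> j \<notin> X} \<subseteq> s ` ?D"
      using ij by (auto simp: s_def)
    then have "card {X \<in> s ` {..<dim_col A}. i \<in> X \<and> j \<notin> X} \<le> card ?D"
      by (intro surj_card_le) auto
    then have "3 \<le> card ?D" using 3 by linarith
    then obtain C where C: "C \<subseteq> ?D" "card C = 3" by (rule obtain_subset_with_card_n)
    from ne obtain d where d: "d < dim_col A" "j \<in> s d" "i \<notin> s d" by blast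
    then have "A $$ (j, d) = 1" "A $$ (i, d) \<noteq> 1" using ij by (simp_all add: s_def)
    moreover have "i < m" "j < m" using ij by simp_all
    ultimately have "F_0_3_1_0 \<prec> A"
      unfolding configuration_F_0_3_1_0_iff[OF A(2)] A(1) using C d(1) by blast
    then show False using A(4) by blast
  qed
  moreover have "s ` {..<dim_col A} \<subseteq> Pow {..<m}" by (auto simp: s_def)
  ultimately show ?thesis using that card by blast
qed

text \<open>The family is listed in any order without repetition and its indicator vectors are taken
  as columns.\<close>

lemma avoids_imp_Avoid:
  assumes "B \<subseteq> Pow {..<m}" "avoids {..<m} B"
  obtains A where "A \<in> Avoid m F_0_3_1_0" "dim_col A = card B"
proof -
  have fB: "finite B" using assms(1) by (meson finite_Pow_iff finite_lessThan finite_subset)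
  then obtain xs where xs: "set xs = B" "distinct xs" using finite_distinct_list by blast
  define A :: "int mat" where "A = mat m (length xs) (\<lambda>(r, c). of_bool (r \<in> xs ! c))"
  have idx: "A $$ (r, c) = of_bool (r \<in> xs ! c)" if "r < m" "c < length xs" for r c
    using that by (simp add: A_def)
  have zo: "zero_one_mat A" by (auto simp: zero_one_mat_def A_def elements_mat_def)
  have "distinct (cols A)"
    unfolding distinct_conv_nth
  proof (intro allI impI notI)
    fix c d assume cd: "c < length (cols A)" "d < length (cols A)" "c \<noteq> d" "cols A ! c = cols A ! d"
    then have l: "c < length xs" "d < length xs" by (simp_all add: A_def)
    have "r \<in> xs ! c \<longleftrightarrow> r \<in> xs ! d" if "r < m" for r
    proof -
      have "col A c $ r = col A d $ r" using cd by simp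
      then show ?thesis using that l by (simp add: A_def of_bool_eq_iff)
    qed
    moreover have "xs ! c \<subseteq> {..<m}" "xs ! d \<subseteq> {..<m}"
      using nth_mem[OF l(1)] nth_mem[OF l(2)] assms(1) xs(1) by blast+
    ultimately have "xs ! c = xs ! d" by blast
    then show False using cd(3) l xs(2) by (simp add: nth_eq_iff_index_eq)
  qed
  moreover have "\<not> F_0_3_1_0 \<prec> A"
  proof
    assume "F_0_3_1_0 \<prec> A"
    then obtain i j C d where ij: "i < m" "j < m"
      and C: "C \<subseteq> {c. c < length xs \<and> A $$ (i, c) = 1 \<and> A $$ (j, c) \<noteq> 1}" "card C = 3"
      and d: "d < length xs" "A $$ (j, d) = 1" "A $$ (i, d) \<noteq> 1"
      unfolding configuration_F_0_3_1_0_iff[OF zo] by (auto simp: A_def)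
    have "inj_on ((!) xs) C" using C(1) xs(2) by (intro inj_on_nth) auto
    then have "card ((!) xs ` C) = 3" using C(2) by (simp add: card_image)
    moreover have "(!) xs ` C \<subseteq> {X \<in> B. i \<in> X \<and> j \<notin> X}"
      using C(1) ij xs(1) by (auto simp: idx subset_eq)
    ultimately have "3 \<le> card {X \<in> B. i \<in> X \<and> j \<notin> X}"
      using fB by (metis (no_types, lifting) card_mono finite_subset mem_Collect_eq subsetI)
    moreover have "xs ! d \<in> {X \<in> B. j \<in> X \<and> i \<notin> X}" using d ij xs(1) by (auto simp: idx)
    ultimately show False using assms(2) ij unfolding avoids_def by blast
  qed
  ultimately have "A \<in> Avoid m F_0_3_1_0" using zo by (simp add: Avoid_def simple_mat_def A_def)
  moreover have "dim_col A = card B" using xs distinct_card by (fastforce simp: A_def)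
  ultimately show ?thesis using that by blast
qed

theorem theorem5:
  fixes m :: nat
  assumes "m \<ge> 3"
  shows "int (forb m F_0_3_1_0) = \<lfloor>(7 / 3) * real m\<rfloor> + 1"
proof -
  have "forb m F_0_3_1_0 = 7 * m div 3 + 1"
    unfolding forb_def
  proof (rule Max_eqI[OF finite_dim_col_Avoid])
    fix n assume "n \<in> dim_col ` Avoid m F_0_3_1_0"
    then obtain B where "B \<subseteq> Pow {..<m}" "avoids {..<m} B" "card B = n"
      using Avoid_imp_avoids by blast
    then have "3 * n \<le> 7 * m + 3" using avoids_card_le[of "{..<m}" B] by simp
    then show "n \<le> 7 * m div 3 + 1" by linarith
  next
    obtain B where "B \<subseteq> Pow {..<m}" "avoids {..<m} B" "card B = 7 * m div 3 + 1"
      using exists_avoids_card[OF assms] by blast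
    then show "7 * m div 3 + 1 \<in> dim_col ` Avoid m F_0_3_1_0"
      using avoids_imp_Avoid by (metis imageI)
  qed
  moreover have "\<lfloor>(7 / 3) * real m\<rfloor> = int (7 * m div 3)"
    using floor_divide_of_nat_eq[of "7 * m" 3, where 'a = real] by simp
  ultimately show ?thesis by simp
qed

end
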